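(* Let $\{\mathsf{P}_\theta : \theta \in \mathbb{T}\}$ be a statistical model for data $Z$ taking values in a sample space $\mathbb{Z}$, where each $\mathsf{P}_\theta$ has a density/mass function $p_\theta$ with respect to a common dominating measure, and assume that $\sup_{\vartheta \in \mathbb{T}} p_\vartheta(z)$ is finite for almost all $z$. Let $$R(z,\theta) = \frac{p_\theta(z)}{\sup_{\vartheta \in \mathbb{T}} p_\vartheta(z)}, \qquad \pi_z(\theta) = \mathsf{P}_\theta\bigl\{ R(Z,\theta) \leq R(z,\theta) \bigr\}, \qquad \theta \in \mathbb{T},\ z \in \mathbb{Z},$$ be the relative likelihood and the contour function of the possibilistic inferential model. Then the possibilistic inferential model is strongly valid in the sense that $$\sup_{\theta \in \mathbb{T}} \mathsf{P}_\theta\bigl\{ \pi_Z(\theta) \leq \alpha \bigr\} \leq \alpha \quad \text{for all } \alpha \in [0,1].$$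
   Context: In $\mathsf{P}_\theta\{\cdots\}$ the random variable is $Z \sim \mathsf{P}_\theta$; in the definition of $\pi_z(\theta)$ the value $z$ is fixed, and $\pi_Z(\theta)$ is the random variable obtained by evaluating $z \mapsto \pi_z(\theta)$ at $Z \sim \mathsf{P}_\theta$. It is assumed that $z \mapsto R(z,\theta)$ is measurable for each $\theta$, so that these probabilities are well defined. The ratio $R(z,\theta)$ may be assigned an arbitrary fixed value, e.g. $0$, at points $z$ where $\sup_\vartheta p_\vartheta(z) \in \{0,\infty\}$ (such $z$ form a $\mathsf{P}_\theta$-null set for every $\theta$). *)

theory Defs
  imports "HOL-Probability.Probability"
begin

definition sup_lik :: "'t set \<Rightarrow> ('t \<Rightarrow> 'z \<Rightarrow> real) \<Rightarrow> 'z \<Rightarrow> ennreal" where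
  "sup_lik T p z = (SUP \<theta>\<in>T. ennreal (p \<theta> z))"

text \<open>The supremum is taken in the extended nonnegative reals, so that it may be infinite. Where it
  is 0 or infinite the ratio has no meaning and is set to an arbitrary constant \<open>c\<close>.\<close>

definition rel_lik :: "real \<Rightarrow> 't set \<Rightarrow> ('t \<Rightarrow> 'z \<Rightarrow> real) \<Rightarrow> 'z \<Rightarrow> 't \<Rightarrow> real" where
  "rel_lik c T p z \<theta> =
     (if sup_lik T p z \<in> {0, \<infinity>} then c else p \<theta> z / enn2real (sup_lik T p z))"

definition contour ::
  "('t \<Rightarrow> 'z measure) \<Rightarrow> real \<Rightarrow> 't set \<Rightarrow> ('t \<Rightarrow> 'z \<Rightarrow> real) \<Rightarrow> 'z \<Rightarrow> 't \<Rightarrow> real" where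
  "contour P c T p z \<theta> =
     measure (P \<theta>) {z' \<in> space (P \<theta>). rel_lik c T p z' \<theta> \<le> rel_lik c T p z \<theta>}"

end

theory Submission imports Defs begin

text \<open>For fixed \<open>\<theta>\<close>, the contour at \<open>Z\<close> is \<open>F(X)\<close>, where \<open>X = R(Z,\<theta>)\<close> and \<open>F\<close> is the distribution
  function of \<open>X\<close>; so the claim is the probability integral transform inequality
  \<open>P(F(X) \<le> \<alpha>) \<le> \<alpha>\<close>. The set \<open>{x. F x \<le> \<alpha>}\<close> is down-closed, and is bounded when \<open>\<alpha> < 1\<close>. With
  supremum \<open>s\<close>, it has mass \<open>F s \<le> \<alpha>\<close> if it contains \<open>s\<close>, and otherwise its mass is the left limit
  of \<open>F\<close> at \<open>s\<close>, which is again at most \<open>\<alpha>\<close>.\<close>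

lemma (in real_distribution) prob_cdf_le:
  assumes "0 \<le> \<alpha>"
  shows "prob {x. cdf M x \<le> \<alpha>} \<le> \<alpha>"
proof -
  define A where "A = {x. cdf M x \<le> \<alpha>}"
  have down: "x \<in> A" if "y \<in> A" "x \<le> y" for x y
    using that cdf_nondecreasing[of x y] by (auto simp: A_def)
  consider "1 \<le> \<alpha>" | "A = {}" | "\<alpha> < 1" "A \<noteq> {}" by linarith
  then have "prob A \<le> \<alpha>"
  proof cases
    case 1
    then show ?thesis by (meson order_trans prob_le_1)
  next
    case 2
    then show ?thesis using assms by simp
  next
    case 3
    \<comment> \<open>\<open>cdf M\<close> tends to 1 > \<alpha> at infinity, so it exceeds \<alpha>
      at some \<open>b\<close>, which bounds the down-closed set \<open>A\<close>.\<close>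
    have "eventually (\<lambda>x. \<alpha> < cdf M x) at_top"
      using cdf_lim_at_top_prob \<open>\<alpha> < 1\<close> by (rule order_tendstoD)
    then obtain b where b: "\<alpha> < cdf M b"
      by (auto simp: eventually_at_top_linorder)
    have bdd: "bdd_above A"
    proof (rule bdd_aboveI)
      show "x \<le> b" if "x \<in> A" for x
        using down[OF that, of b] b by (cases "x \<le> b") (simp_all add: A_def)
    qed
    define s where "s = Sup A"
    have upper: "x \<le> s" if "x \<in> A" for x
      unfolding s_def using that bdd by (rule cSup_upper)
    show ?thesis
    proof (cases "s \<in> A")
      case True
      have "prob A \<le> prob {..s}"
        using upper by (intro finite_measure_mono) auto
      also have "\<dots> \<le> \<alpha>"
        using True by (simp add: A_def cdf_def)
      finally show ?thesis .
    next
      case False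
      \<comment> \<open>Some element of \<open>A\<close> lies above \<open>x\<close>, and
        \<open>A\<close> is down-closed; hence \<open>cdf M\<close> stays at most \<alpha> all the
        way up to its left limit \<open>prob {..<s}\<close>.\<close>
      have below: "x \<in> A" if "x < s" for x
        using that less_cSup_iff[OF \<open>A \<noteq> {}\<close> bdd, of x] down by (auto simp: s_def)
      have "prob A \<le> prob {..<s}"
        using upper False by (intro finite_measure_mono) (auto simp: less_le)
      also have "\<dots> \<le> \<alpha>"
      proof (rule tendsto_upperbound[OF cdf_at_left])
        show "eventually (\<lambda>x. cdf M x \<le> \<alpha>) (at_left s)"
          using below by (auto simp: eventually_at_filter A_def)
      qed simp
      finally show ?thesis .
    qed
  qed
  then show ?thesis by (simp add: A_def)
qed

text \<open>The inner probability is the distribution function of \<open>X\<close> evaluated at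
  \<open>X z\<close>, so the bound for the law of \<open>X\<close> pulls back along
  \<open>X\<close>. Continuity of that law is not assumed.\<close>

lemma (in prob_space) prob_distribution_function_le:
  fixes X :: "'a \<Rightarrow> real"
  assumes [measurable]: "random_variable borel X" and "0 \<le> \<alpha>"
  shows "prob {z \<in> space M. prob {z' \<in> space M. X z' \<le> X z} \<le> \<alpha>} \<le> \<alpha>"
proof -
  interpret D: real_distribution "distr M borel X"
    by (simp add: real_distribution_distr)
  have cdf: "cdf (distr M borel X) x = prob {z' \<in> space M. X z' \<le> x}" for x
    by (simp add: cdf_def measure_distr vimage_def Int_def conj_commute)
  \<comment> \<open>A monotone function is Borel, so its sublevel set is an event and
    \<open>measure_distr\<close> applies to it.\<close>
  have [measurable]: "cdf (distr M borel X) \<in> borel_measurable borel"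
    by (intro borel_measurable_mono monoI D.cdf_nondecreasing)
  have "measure (distr M borel X) {x. cdf (distr M borel X) x \<le> \<alpha>}
      = prob {z \<in> space M. prob {z' \<in> space M. X z' \<le> X z} \<le> \<alpha>}"
    by (subst measure_distr) (auto simp flip: cdf intro!: arg_cong[where f = prob])
  then show ?thesis
    using D.prob_cdf_le[OF \<open>0 \<le> \<alpha>\<close>] by simp
qed

theorem theorem2:
  fixes M :: "'z measure" and T :: "'t set"
    and P :: "'t \<Rightarrow> 'z measure" and p :: "'t \<Rightarrow> 'z \<Rightarrow> real" and c :: real
  assumes prob: "\<And>\<theta>. \<theta> \<in> T \<Longrightarrow> prob_space (P \<theta>)"
    and p_meas: "\<And>\<theta>. \<theta> \<in> T \<Longrightarrow> p \<theta> \<in> borel_measurable M"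
    and p_nonneg: "\<And>\<theta> z. \<theta> \<in> T \<Longrightarrow> z \<in> space M \<Longrightarrow> 0 \<le> p \<theta> z"
    and P_density: "\<And>\<theta>. \<theta> \<in> T \<Longrightarrow> P \<theta> = density M (\<lambda>z. ennreal (p \<theta> z))"
    and sup_finite: "AE z in M. sup_lik T p z < \<infinity>"
    and R_meas: "\<And>\<theta>. \<theta> \<in> T \<Longrightarrow> (\<lambda>z. rel_lik c T p z \<theta>) \<in> borel_measurable M"
  shows "\<forall>\<alpha>\<in>{0..1::real}.
    (SUP \<theta>\<in>T. emeasure (P \<theta>) {z \<in> space (P \<theta>). contour P c T p z \<theta> \<le> \<alpha>}) \<le> ennreal \<alpha>"
proof (intro ballI SUP_least)
  fix \<alpha> :: real and \<theta>
  assume \<alpha>: "\<alpha> \<in> {0..1}" and \<theta>: "\<theta> \<in> T"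
  interpret prob_space "P \<theta>" using \<theta> by (rule prob)
  have "(\<lambda>z. rel_lik c T p z \<theta>) \<in> borel_measurable (P \<theta>)"
    using R_meas[OF \<theta>] by (simp add: P_density[OF \<theta>])
  \<comment> \<open>With \<open>X\<close> the relative likelihood at the fixed \<theta>, the inner
    probability is \<open>contour\<close> by definition.\<close>
  from prob_distribution_function_le[OF this] \<alpha>
  show "emeasure (P \<theta>) {z \<in> space (P \<theta>). contour P c T p z \<theta> \<le> \<alpha>} \<le> ennreal \<alpha>"
    by (simp add: contour_def emeasure_eq_measure)
qed

end
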